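(* Let $G$ be a connected Cartesian matrix graph where $V(G)$ consists of nonempty pairwise disjoint subsets $R_i=\{v_{i,j}\mid j\in J_C\}$, $i\in I_R\subseteq I=\{1,\ldots,m\}$, and of nonempty pairwise disjoint subsets $C_j=\{v_{i,j}\mid i\in I_R\}$, $j\in J_C\subseteq J=\{1,\ldots,n\}$, with $|I_R|=m_1$, $|J_C|=n_1$ and $V(G)=\bigcup_{i\in I_R}R_i=\bigcup_{j\in J_C}C_j$, for which $G[R_x]\cong G[R_y]$ for all $x,y\in I_R$, $G[C_x]\cong G[C_y]$ for all $x,y\in J_C$, the arcs of $A_R=\bigcup_{x\in I_R}A[R_x]$ and the arcs of $A_C=\bigcup_{y\in J_C}A[C_y]$ have no labels in common, and there are no other arcs in $A(G)$ than the arcs of $A_R$ and the arcs of $A_C$. Then $$\operatorname{VRSP}\big(G/_{i\in I_R}R_i,\; G/_{j\in J_C}C_j\big)\;\cong\; G,$$ where $G/_{i\in I_R}R_i$ is obtained from $G$ by successively contracting all the sets $R_i$, $i\in I_R$, and $G/_{j\in J_C}C_j$ by successively contracting all the sets $C_j$, $j\in J_C$.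
   Context: **Graphs.** All graphs are finite labelled acyclic directed multigraphs: a graph $G$ has a vertex set $V(G)$, an arc set $A(G)$, an incidence function $\mu:A(G)\to V(G)\times V(G)$ ($\mu(a)=(u,v)$ means $a$ has tail $u$ and head $v$; $u,v$ are the ends of $a$), and a labelling $\lambda:A(G)\to L(G)$, where each label is a pair $(\ell(a),t(a))$ of a string and a positive real; $L(G)$ is the set of labels occurring on arcs of $G$. Two different arcs with the same tail and head have different labels (parallel arcs with the same label are always replaced by a single arc). Connected means weakly connected. For $X\subseteq V(G)$, $G[X]$ is the subgraph induced by $X$ (all arcs of $G$ with both ends in $X$), and $A[X]$ is its arc set. **Isomorphism.** $G\cong H$ means there is a bijection $\phi:V(G)\to V(H)$ such that, for all $u,v$ and every label $\lambda_0$, $G$ has an arc from $u$ to $v$ with label $\lambda_0$ if and only if $H$ has an arc from $\phi(u)$ to $\phi(v)$ with label $\lambda_0$. **Contraction.** For a nonempty $X\subseteq V(G)$, $G/X$ is obtained by replacing $X$ by one new vertex $\tilde x$, deleting all arcs with both ends in $X$, and replacing every end in $X$ of each remaining arc by $\tilde x$, keeping labels (and merging parallel arcs with equal labels). For a sequence $X_1,\ldots,X_n$ of vertex subsets, $G/_{i=1}^nX_i=G/X_1/\cdots/X_n$ is obtained by successive contraction. **Products.** For graphs $G_1,G_2$ the Cartesian product $G_1\Box G_2$ has vertex set $V(G_1)\times V(G_2)$; each arc $a$ of $G_1$ from $v_1$ to $w_1$ gives, for every $v_2\in V(G_2)$, an arc from $(v_1,v_2)$ to $(w_1,v_2)$ with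 label $\lambda(a)$, and each arc $a$ of $G_2$ from $v_2$ to $w_2$ gives, for every $v_1\in V(G_1)$, an arc from $(v_1,v_2)$ to $(v_1,w_2)$ with label $\lambda(a)$. The intermediate product $G_1\boxtimes G_2$ has the same vertex set; its arcs are (i) the arcs of $G_1\Box G_2$ coming from arcs of $G_1$ with label not in $L(G_2)$, and those coming from arcs of $G_2$ with label not in $L(G_1)$ (asynchronous arcs); and (ii) for each pair of arcs $a_1\in A(G_1)$ from $v_1$ to $w_1$, $a_2\in A(G_2)$ from $v_2$ to $w_2$ with $\lambda(a_1)=\lambda(a_2)$, an arc from $(v_1,v_2)$ to $(w_1,w_2)$ with label $\lambda(a_1)$ (synchronous arcs). The vertex-removing synchronised product (VRSP) $\operatorname{VRSP}(G_1,G_2)$ is obtained from $G_1\boxtimes G_2$ by repeatedly removing (together with all incident arcs) vertices that have in-degree $0$ in the current graph but in-degree $>0$ in $G_1\Box G_2$, and vertices that have out-degree $0$ in the current graph but out-degree $>0$ in $G_1\Box G_2$, until no such vertices remain. **Matrix graphs.** Let $I=\{1,\ldots,m\}$, $J=\{1,\ldots,n\}$, $M=I\times J$. A matrix graph is a graph whose vertices are numbered (bijectively) as $v_{i,j}$ with $(i,j)$ ranging over a subset $M'\subseteq M$. Its rows are $R_i=\{v_{i,j}\in V(G)\mid j\in J\}$ and its columns are $C_j=\{v_{i,j}\in V(G)\mid i\in I\}$. **Cartesian matrix graph.** A matrix graph $G$ with rows $R_i$, $i\in I_R\subseteq I$, and columns $C_j$, $j\in J_C\subseteq J$, such that $G[R_x]\cong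 G[R_y]$ for all $x,y\in I_R$, $G[C_x]\cong G[C_y]$ for all $x,y\in J_C$, the arcs of the graphs $G[R_i]$ and the arcs of the graphs $G[C_j]$ have no labels in common, and every arc of $G$ from $u$ to $v$ satisfies $u,v\in R_i$ for some $i$ or $u,v\in C_j$ for some $j$.
   Formalization: The isomorphisms between G[R_x] and G[R_y], and between G[C_x] and G[C_y], are required to respect the numbering (v_{x,j} to v_{y,j}, v_{i,x} to v_{i,y}); with arbitrary isomorphisms the claim is false. *)

theory Defs
  imports Graph_Theory.Digraph_Component
begin

section \<open>Labelled acyclic directed multigraphs\<close>

type_synonym label = "string \<times> real"

record ('v, 'a) lgraph =
  skel :: "('v, 'a) pre_digraph"
  lab :: "'a \<Rightarrow> label"

abbreviation V :: "('v, 'a) lgraph \<Rightarrow> 'v set" where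
  "V G \<equiv> verts (skel G)"

abbreviation A :: "('v, 'a) lgraph \<Rightarrow> 'a set" where
  "A G \<equiv> arcs (skel G)"

definition labels :: "('v, 'a) lgraph \<Rightarrow> label set" where
  "labels G = lab G ` A G"

definition triple :: "('v, 'a) lgraph \<Rightarrow> 'a \<Rightarrow> 'v \<times> label \<times> 'v" where
  "triple G a = (tail (skel G) a, lab G a, head (skel G) a)"

definition triples :: "('v, 'a) lgraph \<Rightarrow> ('v \<times> label \<times> 'v) set" where
  "triples G = triple G ` A G"

text \<open>Injectivity of \<^term>\<open>triple G\<close> says that parallel arcs have different labels;
  acyclicity of the arc relation also excludes loops.\<close>

definition labelled_dag :: "('v, 'a) lgraph \<Rightarrow> bool" where
  "labelled_dag G \<longleftrightarrow>
     fin_digraph (skel G) \<and> acyclic (arcs_ends (skel G)) \<and>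
     (\<forall>a\<in>A G. snd (lab G a) > 0) \<and> inj_on (triple G) (A G)"

text \<open>\<open>Digraph_Component.connected\<close> is weak connectedness.  The qualified name
  avoids topological connectedness.\<close>

definition wconnected :: "('v, 'a) lgraph \<Rightarrow> bool" where
  "wconnected G \<longleftrightarrow> Digraph_Component.connected (skel G)"

definition induced :: "('v, 'a) lgraph \<Rightarrow> 'v set \<Rightarrow> ('v, 'a) lgraph" where
  "induced G X = \<lparr>skel = skel G \<restriction> X, lab = lab G\<rparr>"

definition is_lgraph_iso :: "('v \<Rightarrow> 'w) \<Rightarrow> ('v, 'a) lgraph \<Rightarrow> ('w, 'b) lgraph \<Rightarrow> bool" where
  "is_lgraph_iso \<phi> G H \<longleftrightarrow>
     bij_betw \<phi> (V G) (V H) \<and>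
     (\<forall>u\<in>V G. \<forall>v\<in>V G. \<forall>l. (u, l, v) \<in> triples G \<longleftrightarrow> (\<phi> u, l, \<phi> v) \<in> triples H)"

definition lgraph_isomorphic :: "('v, 'a) lgraph \<Rightarrow> ('w, 'b) lgraph \<Rightarrow> bool"
    (infix \<open>\<cong>\<^sub>l\<close> 50) where
  "G \<cong>\<^sub>l H \<longleftrightarrow> (\<exists>\<phi>. is_lgraph_iso \<phi> G H)"

text \<open>Graphs arising by contractions and products use (tail, label, head) triples as arcs,
  so that parallel arcs with equal labels are merged automatically.\<close>

type_synonym 'v tgraph = "('v, 'v \<times> label \<times> 'v) lgraph"

definition tgraph :: "'v set \<Rightarrow> ('v \<times> label \<times> 'v) set \<Rightarrow> 'v tgraph" where
  "tgraph W T =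
     \<lparr>skel = \<lparr>verts = W, arcs = T, tail = fst, head = snd \<circ> snd\<rparr>, lab = fst \<circ> snd\<rparr>"


section \<open>Contraction\<close>

text \<open>The argument \<open>x\<close> is the name of the new vertex and must not be a vertex of \<open>G\<close>.\<close>

definition contract :: "'v \<Rightarrow> 'v set \<Rightarrow> ('v, 'a) lgraph \<Rightarrow> 'v tgraph" where
  "contract x X G = (let r = (\<lambda>u. if u \<in> X then x else u) in
     tgraph (insert x (V G - X))
       {(r u, l, r v) | u l v. (u, l, v) \<in> triples G \<and> \<not> (u \<in> X \<and> v \<in> X)})"

text \<open>Successive contraction of \<open>X i\<close> for \<open>i\<close> in \<open>is\<close>. The old vertices are
  tagged \<^const>\<open>Inl\<close>, and \<open>Inr i\<close> is the new vertex replacing \<open>X i\<close>, which makes it fresh.\<close>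

definition contract_seq ::
    "('v, 'a) lgraph \<Rightarrow> ('i \<Rightarrow> 'v set) \<Rightarrow> 'i list \<Rightarrow> ('v + 'i) tgraph" where
  "contract_seq G X is =
     foldl (\<lambda>H i. contract (Inr i) (Inl ` X i) H)
       (tgraph (Inl ` V G) {(Inl u, l, Inl v) | u l v. (u, l, v) \<in> triples G}) is"


section \<open>Products\<close>

definition box :: "('v, 'a) lgraph \<Rightarrow> ('w, 'b) lgraph \<Rightarrow> ('v \<times> 'w) tgraph" where
  "box G1 G2 = tgraph (V G1 \<times> V G2)
     ({((v1, v2), l, (w1, v2)) | v1 l w1 v2. (v1, l, w1) \<in> triples G1 \<and> v2 \<in> V G2} \<union>
      {((v1, v2), l, (v1, w2)) | v1 v2 l w2. (v2, l, w2) \<in> triples G2 \<and> v1 \<in> V G1})"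

definition intermediate :: "('v, 'a) lgraph \<Rightarrow> ('w, 'b) lgraph \<Rightarrow> ('v \<times> 'w) tgraph" where
  "intermediate G1 G2 = tgraph (V G1 \<times> V G2)
     ({((v1, v2), l, (w1, v2)) | v1 l w1 v2.
         (v1, l, w1) \<in> triples G1 \<and> l \<notin> labels G2 \<and> v2 \<in> V G2} \<union>
      {((v1, v2), l, (v1, w2)) | v1 v2 l w2.
         (v2, l, w2) \<in> triples G2 \<and> l \<notin> labels G1 \<and> v1 \<in> V G1} \<union>
      {((v1, v2), l, (w1, w2)) | v1 v2 l w1 w2.
         (v1, l, w1) \<in> triples G1 \<and> (v2, l, w2) \<in> triples G2})"

definition lgraph_del_vert :: "'v \<Rightarrow> ('v, 'a) lgraph \<Rightarrow> ('v, 'a) lgraph" where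
  "lgraph_del_vert x H = \<lparr>skel = pre_digraph.del_vert (skel H) x, lab = lab H\<rparr>"

text \<open>\<open>removable B H x\<close>: the vertex \<open>x\<close> of the current graph \<open>H\<close> has to be removed,
  where \<open>B\<close> is the Cartesian product serving as reference.\<close>

definition removable :: "('v, 'b) lgraph \<Rightarrow> ('v, 'a) lgraph \<Rightarrow> 'v \<Rightarrow> bool" where
  "removable B H x \<longleftrightarrow> x \<in> V H \<and>
     (in_degree (skel H) x = 0 \<and> in_degree (skel B) x > 0 \<or>
      out_degree (skel H) x = 0 \<and> out_degree (skel B) x > 0)"

definition removal_step ::
    "('v, 'b) lgraph \<Rightarrow> ('v, 'a) lgraph \<Rightarrow> ('v, 'a) lgraph \<Rightarrow> bool" where
  "removal_step B H H' \<longleftrightarrow> (\<exists>x. removable B H x \<and> H' = lgraph_del_vert x H)"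

definition is_reduct :: "('v, 'b) lgraph \<Rightarrow> ('v, 'a) lgraph \<Rightarrow> ('v, 'a) lgraph \<Rightarrow> bool" where
  "is_reduct B H K \<longleftrightarrow> (removal_step B)\<^sup>*\<^sup>* H K \<and> (\<nexists>x. removable B K x)"

definition VRSP :: "('v, 'a) lgraph \<Rightarrow> ('w, 'b) lgraph \<Rightarrow> ('v \<times> 'w) tgraph" where
  "VRSP G1 G2 = (THE K. is_reduct (box G1 G2) (intermediate G1 G2) K)"

text \<open>For finite graphs the outcome does not depend on the order of removals, so that the
  definite description in \<^const>\<open>VRSP\<close> is well defined.\<close>

lemma del_vert_commute:
  "lgraph_del_vert x (lgraph_del_vert y H) = lgraph_del_vert y (lgraph_del_vert x H)"
  by (auto simp: lgraph_del_vert_def pre_digraph.del_vert_def)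

lemma removable_del_vert:
  assumes "finite (A H)" "removable B H y" "x \<noteq> y"
  shows "removable B (lgraph_del_vert x H) y"
proof -
  let ?K = "skel (lgraph_del_vert x H)"
  have *: "in_arcs ?K y \<subseteq> in_arcs (skel H) y" "out_arcs ?K y \<subseteq> out_arcs (skel H) y"
    by (auto simp: lgraph_del_vert_def pre_digraph.del_vert_def in_arcs_def out_arcs_def)
  have "finite (in_arcs (skel H) y)" "finite (out_arcs (skel H) y)"
    using assms(1) by (auto simp: in_arcs_def out_arcs_def)
  with * have "in_degree ?K y \<le> in_degree (skel H) y" "out_degree ?K y \<le> out_degree (skel H) y"
    by (auto simp: in_degree_def out_degree_def intro: card_mono)
  then show ?thesis
    using assms(2,3) by (auto simp: removable_def lgraph_del_vert_def pre_digraph.del_vert_def)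
qed

lemma finite_del_vert:
  assumes "finite (V H)" "finite (A H)"
  shows "finite (V (lgraph_del_vert x H))" "finite (A (lgraph_del_vert x H))"
  using assms by (auto simp: lgraph_del_vert_def pre_digraph.del_vert_def)

lemma ex1_is_reduct:
  assumes "finite (V H)" "finite (A H)"
  shows "\<exists>!K. is_reduct B H K"
  using assms
proof (induction "card (V H)" arbitrary: H rule: less_induct)
  case less
  have card_less: "card (V (lgraph_del_vert x H)) < card (V H)" if "removable B H x" for x
    using that less.prems(1) card_Diff1_less[of "V H" x]
    by (auto simp: removable_def lgraph_del_vert_def pre_digraph.del_vert_def)
  have IH: "\<exists>!K. is_reduct B (lgraph_del_vert x H) K" if "removable B H x" for x
    using less.hyps[OF card_less[OF that]] finite_del_vert[OF less.prems] by blast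
  have first: "\<exists>x. removable B H x \<and> is_reduct B (lgraph_del_vert x H) K"
    if "is_reduct B H K" "removable B H z" for K z
    using that unfolding is_reduct_def by (metis converse_rtranclpE removal_step_def)
  have step: "is_reduct B H K" if "removable B H x" "is_reduct B (lgraph_del_vert x H) K" for x K
    using that unfolding is_reduct_def
    by (metis converse_rtranclp_into_rtranclp removal_step_def)
  show ?case
  proof (cases "\<exists>x. removable B H x")
    case False
    then have "is_reduct B H K \<longleftrightarrow> K = H" for K
      unfolding is_reduct_def by (metis converse_rtranclpE removal_step_def rtranclp.rtrancl_refl)
    then show ?thesis by metis
  next
    case True
    then obtain x K where x: "removable B H x" and K: "is_reduct B (lgraph_del_vert x H) K"
      using IH by blast
    have "L = K" if L: "is_reduct B H L" for L
    proof -
      obtain y where y: "removable B H y" and yL: "is_reduct B (lgraph_del_vert y H) L"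
        using first[OF L x] by blast
      show ?thesis
      proof (cases "x = y")
        case True
        then show ?thesis using IH[OF x] K yL by blast
      next
        case False
        have rx: "removable B (lgraph_del_vert y H) x" and ry: "removable B (lgraph_del_vert x H) y"
          using removable_del_vert[OF less.prems(2)] x y False by metis+
        let ?M = "lgraph_del_vert y (lgraph_del_vert x H)"
        have "card (V ?M) \<le> card (V (lgraph_del_vert x H))"
          by (rule card_mono[OF finite_del_vert(1)[OF less.prems]])
             (auto simp: lgraph_del_vert_def pre_digraph.del_vert_def)
        then have "card (V ?M) < card (V H)" using card_less[OF x] by linarith
        moreover have "finite (V ?M)" "finite (A ?M)"
          using less.prems finite_del_vert by metis+
        ultimately obtain N where N: "is_reduct B ?M N" using less.hyps by blast
        have "is_reduct B (lgraph_del_vert x H) N"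
          using N ry unfolding is_reduct_def
          by (metis converse_rtranclp_into_rtranclp removal_step_def)
        moreover have "is_reduct B (lgraph_del_vert y H) N"
          using N rx del_vert_commute[of x y H] unfolding is_reduct_def
          by (metis converse_rtranclp_into_rtranclp removal_step_def)
        ultimately show ?thesis using IH[OF x] IH[OF y] K yL by blast
      qed
    qed
    then show ?thesis using step[OF x K] by blast
  qed
qed


section \<open>Matrix graphs\<close>

definition matrix_graph ::
    "nat \<Rightarrow> nat \<Rightarrow> (nat \<times> nat) set \<Rightarrow> (nat \<Rightarrow> nat \<Rightarrow> 'v) \<Rightarrow> ('v, 'a) lgraph \<Rightarrow> bool" where
  "matrix_graph m n M' v G \<longleftrightarrow>
     labelled_dag G \<and> M' \<subseteq> {1..m} \<times> {1..n} \<and> bij_betw (\<lambda>(i, j). v i j) M' (V G)"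

definition row :: "(nat \<times> nat) set \<Rightarrow> (nat \<Rightarrow> nat \<Rightarrow> 'v) \<Rightarrow> nat \<Rightarrow> 'v set" where
  "row M' v i = {v i j | j. (i, j) \<in> M'}"

definition col :: "(nat \<times> nat) set \<Rightarrow> (nat \<Rightarrow> nat \<Rightarrow> 'v) \<Rightarrow> nat \<Rightarrow> 'v set" where
  "col M' v j = {v i j | i. (i, j) \<in> M'}"

text \<open>Isomorphism of the subgraphs induced by two rows (columns) is understood with respect to
  the numbering: there is an isomorphism that keeps every vertex in its column (row), that is,
  maps \<open>v x j\<close> to \<open>v y j\<close> (respectively \<open>v i x\<close> to \<open>v i y\<close>).  With unrelated isomorphisms
  a Cartesian matrix graph need not be a product: take two rows of three vertices
  whose only row arcs are \<open>v 1 1 \<rightarrow> v 1 2\<close> and \<open>v 2 1 \<rightarrow> v 2 3\<close>, with equal labels, and equally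
  labelled arcs \<open>v 1 j \<rightarrow> v 2 j\<close> for \<open>j = 1, 2, 3\<close>.  This graph has 5 arcs, but the product
  of its two contractions has 7.\<close>

definition cartesian_matrix_graph ::
    "nat \<Rightarrow> nat \<Rightarrow> (nat \<times> nat) set \<Rightarrow> (nat \<Rightarrow> nat \<Rightarrow> 'v) \<Rightarrow> nat set \<Rightarrow> nat set \<Rightarrow>
     ('v, 'a) lgraph \<Rightarrow> bool" where
  "cartesian_matrix_graph m n M' v I\<^sub>R J\<^sub>C G \<longleftrightarrow>
     matrix_graph m n M' v G \<and> I\<^sub>R = fst ` M' \<and> J\<^sub>C = snd ` M' \<and>
     (\<forall>x\<in>I\<^sub>R. \<forall>y\<in>I\<^sub>R. \<exists>\<phi>.
        is_lgraph_iso \<phi> (induced G (row M' v x)) (induced G (row M' v y)) \<and>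
        (\<forall>j\<in>J\<^sub>C. \<phi> ` (row M' v x \<inter> col M' v j) \<subseteq> col M' v j)) \<and>
     (\<forall>x\<in>J\<^sub>C. \<forall>y\<in>J\<^sub>C. \<exists>\<phi>.
        is_lgraph_iso \<phi> (induced G (col M' v x)) (induced G (col M' v y)) \<and>
        (\<forall>i\<in>I\<^sub>R. \<phi> ` (col M' v x \<inter> row M' v i) \<subseteq> row M' v i)) \<and>
     (\<Union>i\<in>I\<^sub>R. labels (induced G (row M' v i))) \<inter> (\<Union>j\<in>J\<^sub>C. labels (induced G (col M' v j))) = {} \<and>
     (\<forall>a\<in>A G.
        (\<exists>i\<in>I\<^sub>R. tail (skel G) a \<in> row M' v i \<and> head (skel G) a \<in> row M' v i) \<or>
        (\<exists>j\<in>J\<^sub>C. tail (skel G) a \<in> col M' v j \<and> head (skel G) a \<in> col M' v j))"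

end

theory Submission
  imports Defs
begin

text \<open>Contracting all rows leaves one vertex per row, and the arcs between them are the
  arcs of a single column, since all columns carry the same arcs; symmetrically for the columns.
  The two contractions share no label, so every arc of their product is asynchronous: the
  intermediate product is the Cartesian product and no vertex is ever removed.  Its
  vertex \<open>(i, j)\<close> corresponds to \<open>v i j\<close>.\<close>

lemma verts_tgraph [simp]: "V (tgraph W T) = W"
  by (simp add: tgraph_def)

lemma triples_tgraph [simp]: "triples (tgraph W T) = T"
  by (force simp: triples_def triple_def tgraph_def)

lemma labels_conv_triples: "labels G = {l. \<exists>u w. (u, l, w) \<in> triples G}"
  by (auto simp: labels_def triples_def triple_def)

lemma verts_induced [simp]: "V (induced G X) = X"
  by (simp add: induced_def)

lemma triples_induced:
  "(u, l, w) \<in> triples (induced G X) \<longleftrightarrow> (u, l, w) \<in> triples G \<and> u \<in> X \<and> w \<in> X"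
  by (auto simp: triples_def triple_def induced_def induce_subgraph_def)

lemma induced_iso_triples:
  assumes "is_lgraph_iso \<phi> (induced G X) (induced G Y)" "u \<in> X" "w \<in> X" "(u, l, w) \<in> triples G"
  shows "(\<phi> u, l, \<phi> w) \<in> triples G"
  using assms unfolding is_lgraph_iso_def verts_induced triples_induced by blast

text \<open>The ends lie in \<open>V G\<close> by well-formedness of \<open>skel G\<close>, and a
  loop would be a cycle of length one in \<open>arcs_ends (skel G)\<close>. Excluding loops later
  ensures that an arc inside a column joins two different rows, so that contracting the rows does
  not delete it.\<close>

lemma labelled_dag_tripleD:
  assumes "labelled_dag G" "(u, l, w) \<in> triples G"
  shows "u \<in> V G" "w \<in> V G" "u \<noteq> w"
proof -
  interpret fin_digraph "skel G"
    using assms(1) by (simp add: labelled_dag_def)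
  obtain a where a: "a \<in> A G" "tail (skel G) a = u" "head (skel G) a = w"
    using assms(2) by (auto simp: triples_def triple_def)
  then show "u \<in> V G" "w \<in> V G" by auto
  have "(u, w) \<in> arcs_ends (skel G)"
    using a by (auto simp: arcs_ends_def arc_to_ends_def)
  then show "u \<noteq> w"
    using assms(1) by (auto simp: labelled_dag_def acyclic_def)
qed

text \<open>This is the invariant of successive contraction. Describing the disjoint sets as fibres
  of one function \<open>cls\<close> gives a closed form for the renaming \<open>q\<close> of
  vertices. The list need not exhaust the classes, so the statement applies to every prefix;
  induction extends the list on the right because the last step of \<open>foldl\<close> is the
  outermost contraction.\<close>

lemma contract_seq_fibres:
  assumes "\<And>i. i \<in> set is \<Longrightarrow> X i = {u \<in> V G. cls u = i}"
    and "\<And>u l w. (u, l, w) \<in> triples G \<Longrightarrow> u \<in> V G \<and> w \<in> V G"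
    and "distinct is"
  shows "contract_seq G X is =
    (let q = (\<lambda>u. if cls u \<in> set is then Inr (cls u) else Inl u) in
     tgraph (Inl ` {u \<in> V G. cls u \<notin> set is} \<union> Inr ` set is)
       {(q u, l, q w) | u l w. (u, l, w) \<in> triples G \<and> \<not> (cls u \<in> set is \<and> cls u = cls w)})"
  using assms(1,3)
proof (induction "is" rule: rev_induct)
  case Nil
  then show ?case by (simp add: contract_seq_def)
next
  case (snoc i "is")
  let ?q = "\<lambda>is u. if cls u \<in> set is then Inr (cls u) else Inl u"
  let ?T = "\<lambda>is. {(?q is u, l, ?q is w) | u l w.
    (u, l, w) \<in> triples G \<and> \<not> (cls u \<in> set is \<and> cls u = cls w)}"
  \<comment> \<open>The renaming that \<open>contract\<close> performs for the last set
    \<open>X i\<close>.\<close>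
  let ?r = "\<lambda>z. if z \<in> Inl ` X i then Inr i else z"
  have Xi: "X i = {u \<in> V G. cls u = i}" and i: "i \<notin> set is"
    using snoc.prems by auto
  have IH: "contract_seq G X is =
      tgraph (Inl ` {u \<in> V G. cls u \<notin> set is} \<union> Inr ` set is) (?T is)"
    using snoc by (simp add: Let_def)
  have r: "?r (?q is u) = ?q (is @ [i]) u" if "u \<in> V G" for u
    using that i by (auto simp: Xi)
  have X: "?q is u \<in> Inl ` X i \<longleftrightarrow> cls u = i" if "u \<in> V G" for u
    using that i by (auto simp: Xi)
  have "{(?r x, l, ?r y) | x l y. (x, l, y) \<in> ?T is \<and> \<not> (x \<in> Inl ` X i \<and> y \<in> Inl ` X i)} =
      {(?r (?q is u), l, ?r (?q is w)) | u l w. (u, l, w) \<in> triples G \<and>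
        \<not> (cls u \<in> set is \<and> cls u = cls w) \<and>
        \<not> (?q is u \<in> Inl ` X i \<and> ?q is w \<in> Inl ` X i)}"
    by blast
  also have "\<dots> = ?T (is @ [i])"
  \<comment> \<open>Both sets range over the same arcs of \<open>G\<close>: lying neither inside an
    earlier class nor inside class \<open>i\<close> means lying inside no class of
    \<open>is @ [i]\<close>.\<close>
  proof (intro Collect_cong iff_exI, goal_cases)
    case (1 z u l w)
    show ?case
    proof (cases "(u, l, w) \<in> triples G")
      case True
      then have u: "u \<in> V G" and w: "w \<in> V G" using assms(2) by blast+
      show ?thesis unfolding r[OF u] r[OF w] X[OF u] X[OF w] by auto
    qed simp
  qed
  finally have arcs: "{(?r x, l, ?r y) | x l y. (x, l, y) \<in> ?T is \<and> \<not> (x \<in> Inl ` X i \<and> y \<in> Inl ` X i)}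
    = ?T (is @ [i])" .
  have "insert (Inr i) (Inl ` {u \<in> V G. cls u \<notin> set is} \<union> Inr ` set is - Inl ` X i) =
      Inl ` {u \<in> V G. cls u \<notin> set (is @ [i])} \<union> Inr ` set (is @ [i])"
    by (auto simp: Xi)
  moreover have "contract_seq G X (is @ [i]) = contract (Inr i) (Inl ` X i) (contract_seq G X is)"
    by (simp add: contract_seq_def)
  ultimately show ?case
    unfolding IH contract_def Let_def verts_tgraph triples_tgraph arcs by simp
qed

text \<open>Once the list covers all classes, no vertex tagged \<open>Inl\<close> survives and the
  result is the quotient of \<open>G\<close> by \<open>cls\<close>, with the arcs inside classes
  removed.\<close>

lemma contract_seq_partition:
  assumes "\<And>i. i \<in> set is \<Longrightarrow> X i = {u \<in> V G. cls u = i}"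
    and "labelled_dag G" "distinct is" "cls ` V G \<subseteq> set is"
  shows "contract_seq G X is =
    tgraph (Inr ` set is)
      {(Inr (cls u), l, Inr (cls w)) | u l w. (u, l, w) \<in> triples G \<and> cls u \<noteq> cls w}"
proof -
  have "contract_seq G X is =
    (let q = (\<lambda>u. if cls u \<in> set is then Inr (cls u) else Inl u) in
     tgraph (Inl ` {u \<in> V G. cls u \<notin> set is} \<union> Inr ` set is)
       {(q u, l, q w) | u l w. (u, l, w) \<in> triples G \<and> \<not> (cls u \<in> set is \<and> cls u = cls w)})"
    using assms labelled_dag_tripleD[OF assms(2)] by (intro contract_seq_fibres) blast+
  moreover have cls: "cls u \<in> set is \<and> cls w \<in> set is" if "(u, l, w) \<in> triples G" for u l w
    using that assms(4) labelled_dag_tripleD[OF assms(2)] by blast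
  have "{(if cls u \<in> set is then Inr (cls u) else Inl u, l,
        if cls w \<in> set is then Inr (cls w) else Inl w) | u l w.
        (u, l, w) \<in> triples G \<and> \<not> (cls u \<in> set is \<and> cls u = cls w)} =
      {(Inr (cls u), l, Inr (cls w)) | u l w. (u, l, w) \<in> triples G \<and> cls u \<noteq> cls w}"
    by (intro Collect_cong iff_exI) (auto dest: cls)
  moreover have "{u \<in> V G. cls u \<notin> set is} = {}"
    using assms(4) by blast
  ultimately show ?thesis by (simp add: Let_def)
qed

text \<open>Without a common label the label conditions on asynchronous arcs always hold and the set
  of synchronous arcs is empty, so removal starts from the Cartesian product itself.\<close>

lemma VRSP_disjoint_labels:
  assumes "labels G1 \<inter> labels G2 = {}"
  shows "VRSP G1 G2 = box G1 G2"
proof -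
  have "l \<notin> labels G2" if "(u, l, w) \<in> triples G1" for u l w
    using that assms by (auto simp: labels_conv_triples)
  moreover have "l \<notin> labels G1" if "(u, l, w) \<in> triples G2" for u l w
    using that assms by (auto simp: labels_conv_triples)
  moreover have "\<not> ((u, l, w) \<in> triples G1 \<and> (u', l, w') \<in> triples G2)" for u l w u' w'
    using assms by (auto simp: labels_conv_triples)
  ultimately have "intermediate G1 G2 = box G1 G2"
    unfolding intermediate_def box_def
    by (intro arg_cong2[where f = tgraph] refl) blast
  moreover have "is_reduct (box G1 G2) (box G1 G2) K \<longleftrightarrow> K = box G1 G2" for K
  proof -
    \<comment> \<open>Current graph and reference coincide, so a removable vertex would have a
      degree that is both zero and positive. Hence the only reduct is the graph itself, which
      determines the definite description.\<close>
    have "\<not> removable (box G1 G2) (box G1 G2) x" for x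
      by (auto simp: removable_def)
    then show ?thesis
      unfolding is_reduct_def by (metis converse_rtranclpE removal_step_def rtranclp.rtrancl_refl)
  qed
  ultimately show ?thesis by (simp add: VRSP_def)
qed

theorem theorem4:
  fixes G :: "('v, 'a) lgraph"
    and v :: "nat \<Rightarrow> nat \<Rightarrow> 'v"
    and R C :: "nat \<Rightarrow> 'v set"
    and I\<^sub>R J\<^sub>C :: "nat set"
    and m n m\<^sub>1 n\<^sub>1 :: nat
  assumes "cartesian_matrix_graph m n (I\<^sub>R \<times> J\<^sub>C) v I\<^sub>R J\<^sub>C G"
    and "wconnected G"
    and "I\<^sub>R \<subseteq> {1..m}" and "J\<^sub>C \<subseteq> {1..n}"
    and "card I\<^sub>R = m\<^sub>1" and "card J\<^sub>C = n\<^sub>1"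
    and "\<forall>i\<in>I\<^sub>R. R i = {v i j | j. j \<in> J\<^sub>C}"
    and "\<forall>j\<in>J\<^sub>C. C j = {v i j | i. i \<in> I\<^sub>R}"
    and "\<forall>i\<in>I\<^sub>R. R i \<noteq> {}" and "disjoint_family_on R I\<^sub>R" and "V G = (\<Union>i\<in>I\<^sub>R. R i)"
    and "\<forall>j\<in>J\<^sub>C. C j \<noteq> {}" and "disjoint_family_on C J\<^sub>C" and "V G = (\<Union>j\<in>J\<^sub>C. C j)"
  shows "VRSP (contract_seq G R (sorted_list_of_set I\<^sub>R)) (contract_seq G C (sorted_list_of_set J\<^sub>C))
         \<cong>\<^sub>l G"
proof -

  \<comment> \<open>Coordinates and arcs of the matrix graph\<close>
  let ?M = "I\<^sub>R \<times> J\<^sub>C"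
  have dag: "labelled_dag G" and bij: "bij_betw (\<lambda>(i, j). v i j) ?M (V G)"
    and row_iso: "\<forall>x\<in>I\<^sub>R. \<forall>y\<in>I\<^sub>R. \<exists>\<phi>.
      is_lgraph_iso \<phi> (induced G (row ?M v x)) (induced G (row ?M v y)) \<and>
      (\<forall>j\<in>J\<^sub>C. \<phi> ` (row ?M v x \<inter> col ?M v j) \<subseteq> col ?M v j)"
    and col_iso: "\<forall>x\<in>J\<^sub>C. \<forall>y\<in>J\<^sub>C. \<exists>\<phi>.
      is_lgraph_iso \<phi> (induced G (col ?M v x)) (induced G (col ?M v y)) \<and>
      (\<forall>i\<in>I\<^sub>R. \<phi> ` (col ?M v x \<inter> row ?M v i) \<subseteq> row ?M v i)"
    and disj: "(\<Union>i\<in>I\<^sub>R. labels (induced G (row ?M v i))) \<inter>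
      (\<Union>j\<in>J\<^sub>C. labels (induced G (col ?M v j))) = {}"
    and arcs: "\<forall>a\<in>A G.
      (\<exists>i\<in>I\<^sub>R. tail (skel G) a \<in> row ?M v i \<and> head (skel G) a \<in> row ?M v i) \<or>
      (\<exists>j\<in>J\<^sub>C. tail (skel G) a \<in> col ?M v j \<and> head (skel G) a \<in> col ?M v j)"
    using assms(1) unfolding cartesian_matrix_graph_def matrix_graph_def by - (elim conjE, assumption)+
  have row: "row ?M v i = {v i j | j. j \<in> J\<^sub>C}" if "i \<in> I\<^sub>R" for i
    using that by (auto simp: row_def)
  have col: "col ?M v j = {v i j | i. i \<in> I\<^sub>R}" if "j \<in> J\<^sub>C" for j
    using that by (auto simp: col_def)
  have inj: "i = i' \<and> j = j'"
    if "v i j = v i' j'" "i \<in> I\<^sub>R" "i' \<in> I\<^sub>R" "j \<in> J\<^sub>C" "j' \<in> J\<^sub>C" for i j i' j'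
    using inj_onD[OF bij_betw_imp_inj_on[OF bij], of "(i, j)" "(i', j')"] that by simp
  \<comment> \<open>The coordinate map, inverse to the numbering: rows are the fibres of
    \<open>fst \<circ> p\<close>, columns those of \<open>snd \<circ> p\<close>.\<close>
  define p where "p = inv_into ?M (\<lambda>(i, j). v i j)"
  have p: "p (v i j) = (i, j)" if "i \<in> I\<^sub>R" "j \<in> J\<^sub>C" for i j
    using inv_into_f_f[OF bij_betw_imp_inj_on[OF bij], of "(i, j)"] that by (simp add: p_def)
  have VG: "V G = {v i j | i j. i \<in> I\<^sub>R \<and> j \<in> J\<^sub>C}"
    unfolding bij_betw_imp_surj_on[OF bij, symmetric] by auto
  \<comment> \<open>An arc stays in a row or in a column, so one coordinate is fixed; the other must
    change because there are no loops.\<close>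
  have arc: "\<exists>i\<in>I\<^sub>R. \<exists>j\<in>J\<^sub>C. \<exists>i'\<in>I\<^sub>R. \<exists>j'\<in>J\<^sub>C. u = v i j \<and> w = v i' j' \<and> (i = i' \<or> j = j') \<and> \<not> (i = i' \<and> j = j')"
    if t: "(u, l, w) \<in> triples G" for u l w
  proof -
    obtain a where a: "a \<in> A G" "tail (skel G) a = u" "head (skel G) a = w"
      using t by (auto simp: triples_def triple_def)
    have "u \<noteq> w" using labelled_dag_tripleD[OF dag t] by blast
    moreover have "(\<exists>i\<in>I\<^sub>R. u \<in> row ?M v i \<and> w \<in> row ?M v i) \<or> (\<exists>j\<in>J\<^sub>C. u \<in> col ?M v j \<and> w \<in> col ?M v j)"
      using arcs a by blast
    ultimately show ?thesis by (auto simp: row_def col_def)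
  qed
  \<comment> \<open>Row arcs can be copied from row to row because the isomorphism of rows respects
    columns.\<close>
  have row_arc: "(v y j, l, v y j') \<in> triples G"
    if t: "(v x j, l, v x j') \<in> triples G" and x: "x \<in> I\<^sub>R" and y: "y \<in> I\<^sub>R"
      and j: "j \<in> J\<^sub>C" "j' \<in> J\<^sub>C" for x y j j' l
  proof -
    obtain \<phi> where \<phi>: "is_lgraph_iso \<phi> (induced G (row ?M v x)) (induced G (row ?M v y))"
      "\<forall>j\<in>J\<^sub>C. \<phi> ` (row ?M v x \<inter> col ?M v j) \<subseteq> col ?M v j"
      using row_iso[rule_format, OF x y] by blast
    \<comment> \<open>The image lies in row \<open>y\<close> and in column \<open>k\<close>, which
      meet only in \<open>v y k\<close>.\<close>
    have "\<phi> (v x k) = v y k" if k: "k \<in> J\<^sub>C" for k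
    proof -
      have "v x k \<in> row ?M v x" "v x k \<in> col ?M v k"
        using x k by (auto simp: row_def col_def)
      moreover from this have "\<phi> (v x k) \<in> row ?M v y"
        using \<phi>(1) by (auto simp: is_lgraph_iso_def dest: bij_betwE)
      ultimately have "\<phi> (v x k) \<in> row ?M v y" "\<phi> (v x k) \<in> col ?M v k"
        using \<phi>(2) k by blast+
      then show ?thesis using y k by (auto simp: row col dest: inj)
    qed
    then show ?thesis
      using induced_iso_triples[OF \<phi>(1) _ _ t] x j by (auto simp: row)
  qed
  have col_arc: "(v i y, l, v i' y) \<in> triples G"
    if t: "(v i x, l, v i' x) \<in> triples G" and x: "x \<in> J\<^sub>C" and y: "y \<in> J\<^sub>C"
      and i: "i \<in> I\<^sub>R" "i' \<in> I\<^sub>R" for x y i i' l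
  proof -
    obtain \<phi> where \<phi>: "is_lgraph_iso \<phi> (induced G (col ?M v x)) (induced G (col ?M v y))"
      "\<forall>i\<in>I\<^sub>R. \<phi> ` (col ?M v x \<inter> row ?M v i) \<subseteq> row ?M v i"
      using col_iso[rule_format, OF x y] by blast
    have "\<phi> (v k x) = v k y" if k: "k \<in> I\<^sub>R" for k
    proof -
      have "v k x \<in> col ?M v x" "v k x \<in> row ?M v k"
        using x k by (auto simp: row_def col_def)
      moreover from this have "\<phi> (v k x) \<in> col ?M v y"
        using \<phi>(1) by (auto simp: is_lgraph_iso_def dest: bij_betwE)
      ultimately have "\<phi> (v k x) \<in> col ?M v y" "\<phi> (v k x) \<in> row ?M v k"
        using \<phi>(2) k by blast+
      then show ?thesis using y k by (auto simp: row col dest: inj)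
    qed
    then show ?thesis
      using induced_iso_triples[OF \<phi>(1) _ _ t] x i by (auto simp: col)
  qed

  \<comment> \<open>The two contractions and their labels\<close>
  let ?GR = "contract_seq G R (sorted_list_of_set I\<^sub>R)"
  let ?GC = "contract_seq G C (sorted_list_of_set J\<^sub>C)"
  have fin: "finite I\<^sub>R" "finite J\<^sub>C"
    using assms(3,4) finite_subset by blast+
  have "R i = {u \<in> V G. (fst \<circ> p) u = i}" if "i \<in> I\<^sub>R" for i
    using that assms(7) by (auto simp: VG p)
  then have GR: "?GR = tgraph (Inr ` I\<^sub>R) {(Inr ((fst \<circ> p) u), l, Inr ((fst \<circ> p) w)) | u l w.
      (u, l, w) \<in> triples G \<and> (fst \<circ> p) u \<noteq> (fst \<circ> p) w}"
    using fin dag by (subst contract_seq_partition[where cls = "fst \<circ> p"]) (auto simp: VG p)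
  have "C j = {u \<in> V G. (snd \<circ> p) u = j}" if "j \<in> J\<^sub>C" for j
    using that assms(8) by (auto simp: VG p)
  then have GC: "?GC = tgraph (Inr ` J\<^sub>C) {(Inr ((snd \<circ> p) u), l, Inr ((snd \<circ> p) w)) | u l w.
      (u, l, w) \<in> triples G \<and> (snd \<circ> p) u \<noteq> (snd \<circ> p) w}"
    using fin dag by (subst contract_seq_partition[where cls = "snd \<circ> p"]) (auto simp: VG p)
  have V_GR: "V ?GR = Inr ` I\<^sub>R" and V_GC: "V ?GC = Inr ` J\<^sub>C"
    unfolding GR GC by simp_all
  have GR_cases: "\<exists>i\<in>I\<^sub>R. \<exists>i'\<in>I\<^sub>R. x = Inr i \<and> y = Inr i' \<and> i \<noteq> i' \<and> (\<exists>j\<in>J\<^sub>C. (v i j, l, v i' j) \<in> triples G)"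
    if xy: "(x, l, y) \<in> triples ?GR" for x l y
  proof -
    obtain u w where uw: "(u, l, w) \<in> triples G" "fst (p u) \<noteq> fst (p w)"
        "x = Inr (fst (p u))" "y = Inr (fst (p w))"
      using xy unfolding GR triples_tgraph by auto
    \<comment> \<open>The ends differ in the first coordinate, so they agree in the second; this
      common column is the witness \<open>j\<close>.\<close>
    then show ?thesis using arc[OF uw(1)] p by auto
  qed
  have GC_cases: "\<exists>j\<in>J\<^sub>C. \<exists>j'\<in>J\<^sub>C. x = Inr j \<and> y = Inr j' \<and> j \<noteq> j' \<and> (\<exists>i\<in>I\<^sub>R. (v i j, l, v i j') \<in> triples G)"
    if xy: "(x, l, y) \<in> triples ?GC" for x l y
  proof -
    obtain u w where uw: "(u, l, w) \<in> triples G" "snd (p u) \<noteq> snd (p w)"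
        "x = Inr (snd (p u))" "y = Inr (snd (p w))"
      using xy unfolding GC triples_tgraph by auto
    then show ?thesis using arc[OF uw(1)] p by auto
  qed
  \<comment> \<open>An arc of the contraction stems from some column, and \<open>col_arc\<close>
    moves it to the prescribed column \<open>j\<close>. Thus every single column is a copy of the
    contraction of the rows.\<close>
  have GR_arc: "(Inr i, l, Inr i') \<in> triples ?GR \<longleftrightarrow> (v i j, l, v i' j) \<in> triples G"
    if "i \<in> I\<^sub>R" "i' \<in> I\<^sub>R" "j \<in> J\<^sub>C" for i i' j l
  proof
    assume "(Inr i, l, Inr i') \<in> triples ?GR"
    then show "(v i j, l, v i' j) \<in> triples G"
      using GR_cases that col_arc by blast
  next
    assume t: "(v i j, l, v i' j) \<in> triples G"
    then have "i \<noteq> i'" using labelled_dag_tripleD[OF dag] by blast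
    then show "(Inr i, l, Inr i') \<in> triples ?GR"
      using t that unfolding GR triples_tgraph
      by (intro CollectI exI[of _ "v i j"] exI[of _ l] exI[of _ "v i' j"]) (simp add: p)
  qed
  have GC_arc: "(Inr j, l, Inr j') \<in> triples ?GC \<longleftrightarrow> (v i j, l, v i j') \<in> triples G"
    if "j \<in> J\<^sub>C" "j' \<in> J\<^sub>C" "i \<in> I\<^sub>R" for j j' i l
  proof
    assume "(Inr j, l, Inr j') \<in> triples ?GC"
    then show "(v i j, l, v i j') \<in> triples G"
      using GC_cases that row_arc by blast
  next
    assume t: "(v i j, l, v i j') \<in> triples G"
    then have "j \<noteq> j'" using labelled_dag_tripleD[OF dag] by blast
    then show "(Inr j, l, Inr j') \<in> triples ?GC"
      using t that unfolding GC triples_tgraph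
      by (intro CollectI exI[of _ "v i j"] exI[of _ l] exI[of _ "v i j'"]) (simp add: p)
  qed
  \<comment> \<open>Contracting rows leaves only labels of column arcs, and contracting columns only
    labels of row arcs; these two sets of labels are disjoint by hypothesis.\<close>
  have "labels ?GR \<subseteq> (\<Union>j\<in>J\<^sub>C. labels (induced G (col ?M v j)))"
  proof
    fix l assume "l \<in> labels ?GR"
    then obtain i i' j where "i \<in> I\<^sub>R" "i' \<in> I\<^sub>R" "j \<in> J\<^sub>C" "(v i j, l, v i' j) \<in> triples G"
      unfolding labels_conv_triples using GR_cases by blast
    then show "l \<in> (\<Union>j\<in>J\<^sub>C. labels (induced G (col ?M v j)))"
      unfolding labels_conv_triples triples_induced by (auto simp: col_def)
  qed
  moreover have "labels ?GC \<subseteq> (\<Union>i\<in>I\<^sub>R. labels (induced G (row ?M v i)))"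
  proof
    fix l assume "l \<in> labels ?GC"
    then obtain j j' i where "j \<in> J\<^sub>C" "j' \<in> J\<^sub>C" "i \<in> I\<^sub>R" "(v i j, l, v i j') \<in> triples G"
      unfolding labels_conv_triples using GC_cases by blast
    then show "l \<in> (\<Union>i\<in>I\<^sub>R. labels (induced G (row ?M v i)))"
      unfolding labels_conv_triples triples_induced by (auto simp: row_def)
  qed
  ultimately have VRSP: "VRSP ?GR ?GC = box ?GR ?GC"
    using disj by (intro VRSP_disjoint_labels) blast

  \<comment> \<open>The isomorphism from the Cartesian product to \<open>G\<close>\<close>
  define \<psi> :: "('v + nat) \<times> ('v + nat) \<Rightarrow> 'v" where "\<psi> = (\<lambda>(x, y). v (projr x) (projr y))"
  \<comment> \<open>All vertices of both contractions are tagged \<open>Inr\<close>, so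
    \<open>projr\<close> recovers the row and column index; its values on \<open>Inl\<close> never
    matter.\<close>
  have \<psi> [simp]: "\<psi> (Inr i, Inr j) = v i j" for i j by (simp add: \<psi>_def)
  have V_box: "V (box ?GR ?GC) = Inr ` I\<^sub>R \<times> Inr ` J\<^sub>C"
    unfolding box_def verts_tgraph V_GR V_GC ..
  have box_arc: "((x, y), l, (x', y')) \<in> triples (box ?GR ?GC) \<longleftrightarrow>
      (x, l, x') \<in> triples ?GR \<and> y = y' \<and> y \<in> V ?GC \<or> (y, l, y') \<in> triples ?GC \<and> x = x' \<and> x \<in> V ?GR"
    for x y l x' y'
    unfolding box_def triples_tgraph by blast
  have "bij_betw \<psi> (V (box ?GR ?GC)) (V G)"
    unfolding V_box VG by (rule bij_betw_imageI) (force simp: inj_on_def dest: inj)+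
  moreover have "((Inr i, Inr j), l, (Inr i', Inr j')) \<in> triples (box ?GR ?GC) \<longleftrightarrow>
      (v i j, l, v i' j') \<in> triples G"
    if ij: "i \<in> I\<^sub>R" "j \<in> J\<^sub>C" "i' \<in> I\<^sub>R" "j' \<in> J\<^sub>C" for i j i' j' l
  proof
    assume "((Inr i, Inr j), l, (Inr i', Inr j')) \<in> triples (box ?GR ?GC)"
    then show "(v i j, l, v i' j') \<in> triples G"
      unfolding box_arc using GR_arc GC_arc ij by blast
  next
    assume t: "(v i j, l, v i' j') \<in> triples G"
    \<comment> \<open>An arc of \<open>G\<close> changes only one coordinate, so it comes from an
      arc of one factor with the vertex of the other factor fixed.\<close>
    then have "i = i' \<or> j = j'" using arc[OF t] ij by (metis inj)
    then show "((Inr i, Inr j), l, (Inr i', Inr j')) \<in> triples (box ?GR ?GC)"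
      unfolding box_arc V_GR V_GC using GR_arc GC_arc ij t by blast
  qed
  ultimately have "is_lgraph_iso \<psi> (box ?GR ?GC) G"
    unfolding is_lgraph_iso_def V_box by auto
  then show ?thesis
    unfolding VRSP lgraph_isomorphic_def by blast
qed

end
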